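(* Let $G$ be a finite group which is not a $p$-group (for any prime $p$). If the center $Z(G)$ is non-trivial, then the difference graph $D(G)$ is connected and $\operatorname{diam}(D(G))\leq 6$.
   Context: For a group $G$, the power graph $\mathsf{Pow}(G)$ has vertex set $G$, with distinct $a,b$ adjacent iff $a\in\langle b\rangle$ or $b\in\langle a\rangle$. The enhanced power graph $\mathsf{EPow}(G)$ has vertex set $G$, with distinct $a,b$ adjacent iff $\langle a,b\rangle$ is cyclic. The difference graph $D(G)$ is the graph $\mathsf{EPow}(G)-\mathsf{Pow}(G)$ with all isolated vertices removed; thus $x\sim y$ in $D(G)$ iff $\langle x,y\rangle$ is cyclic, $x\notin\langle y\rangle$ and $y\notin\langle x\rangle$. *)

theory Defs
  imports "HOL-Computational_Algebra.Primes" "HOL-Algebra.Elementary_Groups" "Graph_Theory.Graph_Theory"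
begin

definition center :: "('a, 'b) monoid_scheme \<Rightarrow> 'a set" where
  "center G = {z \<in> carrier G. \<forall>g \<in> carrier G. z \<otimes>\<^bsub>G\<^esub> g = g \<otimes>\<^bsub>G\<^esub> z}"

text \<open>Intended for finite groups; the trivial group is a \<open>p\<close>-group for every \<open>p\<close>.\<close>

definition p_group :: "nat \<Rightarrow> ('a, 'b) monoid_scheme \<Rightarrow> bool" where
  "p_group p G \<longleftrightarrow> group G \<and> (\<exists>n. order G = p ^ n)"

text \<open>Undirected simple graphs are loop-free symmetric digraphs without parallel arcs:
  an edge is represented by both of its orientations.\<close>

definition power_graph :: "('a, 'b) monoid_scheme \<Rightarrow> 'a pair_pre_digraph" where
  "power_graph G = \<lparr> pverts = carrier G,
     parcs = {(a, b). a \<in> carrier G \<and> b \<in> carrier G \<and> a \<noteq> b \<and>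
                      (a \<in> generate G {b} \<or> b \<in> generate G {a})} \<rparr>"

definition enhanced_power_graph :: "('a, 'b) monoid_scheme \<Rightarrow> 'a pair_pre_digraph" where
  "enhanced_power_graph G = \<lparr> pverts = carrier G,
     parcs = {(a, b). a \<in> carrier G \<and> b \<in> carrier G \<and> a \<noteq> b \<and>
                      cyclic_group (subgroup_generated G {a, b})} \<rparr>"

definition remove_edges :: "'a pair_pre_digraph \<Rightarrow> 'a pair_pre_digraph \<Rightarrow> 'a pair_pre_digraph" where
  "remove_edges H K = \<lparr> pverts = pverts H, parcs = parcs H - parcs K \<rparr>"

definition remove_isolated :: "'a pair_pre_digraph \<Rightarrow> 'a pair_pre_digraph" where
  "remove_isolated H = \<lparr> pverts = pverts H \<inter> Field (parcs H), parcs = parcs H \<rparr>"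

definition difference_graph :: "('a, 'b) monoid_scheme \<Rightarrow> 'a pair_pre_digraph" where
  "difference_graph G = remove_isolated (remove_edges (enhanced_power_graph G) (power_graph G))"

text \<open>The distance is the least length of a walk (\<open>\<infinity>\<close> if there is none), that is, the
  shortest-path cost \<open>\<mu>\<close> for unit arc weights. The supremum over the null graph
  is \<open>-\<infinity>\<close>.\<close>

definition graph_distance :: "'a pair_pre_digraph \<Rightarrow> 'a \<Rightarrow> 'a \<Rightarrow> ereal" where
  "graph_distance H u v = wf_digraph.\<mu> (with_proj H) (\<lambda>_. 1) u v"

definition diameter :: "'a pair_pre_digraph \<Rightarrow> ereal" where
  "diameter H = (SUP u \<in> pverts H. SUP v \<in> pverts H. graph_distance H u v)"

lemma difference_graph_adjacent_iff:
  assumes "group G"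
  shows "(x, y) \<in> parcs (difference_graph G) \<longleftrightarrow>
    x \<in> carrier G \<and> y \<in> carrier G \<and> cyclic_group (subgroup_generated G {x, y}) \<and>
    x \<notin> generate G {y} \<and> y \<notin> generate G {x}"
  by (auto simp: difference_graph_def remove_isolated_def remove_edges_def
      enhanced_power_graph_def power_graph_def intro: generate.incl)

lemma pair_graph_difference_graph:
  assumes "group G" "finite (carrier G)"
  shows "pair_graph (difference_graph G)"
proof -
  let ?D = "difference_graph G"
  have arcs: "parcs ?D \<subseteq> carrier G \<times> carrier G"
    using difference_graph_adjacent_iff[OF assms(1)] by auto
  have verts: "pverts ?D = Field (parcs ?D)" "pverts ?D \<subseteq> carrier G"
    by (auto simp: difference_graph_def remove_isolated_def remove_edges_def
        enhanced_power_graph_def power_graph_def Field_def)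
  have sym: "sym (parcs ?D)"
    by (auto simp: sym_def difference_graph_adjacent_iff[OF assms(1)] insert_commute)
  show ?thesis
  proof unfold_locales
    show "fst e \<in> pverts ?D" "snd e \<in> pverts ?D" if "e \<in> parcs ?D" for e
      using that verts(1) by (cases e; force simp: Field_def)+
    show "finite (pverts ?D)"
      using verts(2) assms(2) by (rule finite_subset)
    show "finite (parcs ?D)"
      using arcs assms(2) by (meson finite_SigmaI finite_subset)
    show "fst e \<noteq> snd e" if "e \<in> parcs ?D" for e
      using that by (cases e) (auto simp: difference_graph_adjacent_iff[OF assms(1)] intro: generate.incl)
    show "symmetric (with_proj ?D)"
      using sym by (simp add: symmetric_def)
  qed
qed

lemma graph_distance_eq_INF_length:
  assumes "pair_wf_digraph H"
  shows "graph_distance H u v =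
    (INF p \<in> {p. pre_digraph.awalk (with_proj H) u p v}. ereal (real (length p)))"
proof -
  interpret pair_wf_digraph H by (rule assms)
  show ?thesis
    by (simp add: graph_distance_def \<mu>_def awalk_cost_def sum_list_triv)
qed

end

theory Submission
  imports Defs "HOL-Algebra.Sylow" "HOL-Algebra.Multiplicative_Group"
begin

text \<open>Let \<open>|G| = p\<^sup>a m\<close> with \<open>p \<nmid> m\<close>, where the prime \<open>p\<close> is the order of a central element \<open>z\<close>.
  Every \<open>w \<noteq> 1\<close> with \<open>w\<^sup>m = 1\<close> is adjacent to \<open>z\<close>. Given an edge \<open>x \<sim> y\<close>, the
  \<open>p'\<close>-part of \<open>y\<close> is adjacent to \<open>x\<close> unless it lies in \<open>\<langle>x\<rangle>\<close>, and symmetrically. They cannot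
  both fail, since then the \<open>p\<close>-parts of \<open>x\<close> and \<open>y\<close> would be incomparable elements of a cyclic
  group. Hence every vertex is at distance at most 3 from \<open>z\<close>.\<close>

section \<open>Cyclic subgroups\<close>

context group
begin

lemma generate_singleton_iff:
  assumes "x \<in> carrier G"
  shows "y \<in> generate G {x} \<longleftrightarrow> (\<exists>k::int. y = x [^] k)"
  using generate_pow[OF assms] by auto

lemma generate_singleton_subset:
  assumes "x \<in> carrier G" "y \<in> generate G {x}"
  shows "generate G {y} \<subseteq> generate G {x}"
  using assms by (intro generate_subgroup_incl generate_is_subgroup) auto

lemma int_pow_mem_generate:
  assumes "x \<in> carrier G"
  shows "x [^] (k::int) \<in> generate G {x}"
  using assms generate_singleton_iff by blast

lemma nat_pow_mem_generate:
  assumes "x \<in> carrier G"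
  shows "x [^] (k::nat) \<in> generate G {x}"
  using int_pow_mem_generate[OF assms, of "int k"] by (simp add: int_pow_int)

lemma int_pow_mem_subgroup:
  assumes "subgroup H G" "x \<in> H"
  shows "x [^] (k::int) \<in> H"
  using assms generate_subgroup_incl[of "{x}" H] int_pow_mem_generate[of x k]
    subgroup.subset[OF assms(1)] by auto

text \<open>Turns edges of the enhanced power graph into the existence of a common cyclic overgroup
  \<langle>c\<rangle>, a condition that passes to powers of \<open>x\<close> and \<open>y\<close>.
  From right to left this is the fact that subgroups of cyclic groups are cyclic.\<close>

lemma cyclic_subgroup_generated_pair_iff:
  assumes x: "x \<in> carrier G" and y: "y \<in> carrier G"
  shows "cyclic_group (subgroup_generated G {x, y}) \<longleftrightarrow>
    (\<exists>c \<in> carrier G. x \<in> generate G {c} \<and> y \<in> generate G {c})" (is "?L \<longleftrightarrow> ?R")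
proof
  let ?S = "subgroup_generated G {x, y}"
  have carr: "carrier ?S = generate G {x, y}"
    using x y by (simp add: carrier_subgroup_generated)
  have sub: "generate G {x, y} \<subseteq> carrier G"
    using x y by (intro generate_incl) auto
  assume ?L
  then obtain c where c: "c \<in> carrier ?S" "carrier ?S = range (\<lambda>n::int. c [^]\<^bsub>?S\<^esub> n)"
    unfolding group.cyclic_group[OF group_subgroup_generated] by (elim bexE)
  have cG: "c \<in> carrier G"
    using c(1) carr sub by auto
  have "carrier ?S \<subseteq> generate G {c}"
  proof
    fix w
    assume "w \<in> carrier ?S"
    then obtain n :: int where "w = c [^]\<^bsub>?S\<^esub> n"
      using c(2) by blast
    then show "w \<in> generate G {c}"
      using int_pow_mem_generate[OF cG] int_pow_subgroup_generated[OF c(1)] by simp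
  qed
  moreover have "x \<in> carrier ?S" "y \<in> carrier ?S"
    unfolding carr by (simp_all add: generate.incl)
  ultimately show ?R
    using cG by blast
next
  assume ?R
  then obtain c where c: "c \<in> carrier G" and xy: "x \<in> generate G {c}" "y \<in> generate G {c}"
    by blast
  obtain i j :: int where i: "x = c [^] i" and j: "y = c [^] j"
    using xy generate_singleton_iff[OF c] by blast
  \<comment> \<open>By Bezout, \<open>c [^] gcd i j\<close> is a product of powers of
    \<open>x\<close> and \<open>y\<close>, so it is the generator sought.\<close>
  obtain u v where uv: "u * i + v * j = gcd i j"
    using bezout_int[of i j] by blast
  define g where "g = c [^] gcd i j"
  have g: "g \<in> carrier G"
    using c by (simp add: g_def)
  have "x [^] u \<otimes> y [^] v = c [^] (u * i + v * j)"
    using c by (simp add: i j int_pow_pow int_pow_mult mult.commute)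
  then have "g = x [^] u \<otimes> y [^] v"
    by (simp only: uv g_def)
  moreover have S: "subgroup (generate G {x, y}) G"
    using x y by (intro generate_is_subgroup) auto
  have "x [^] u \<in> generate G {x, y}" "y [^] v \<in> generate G {x, y}"
    by (rule int_pow_mem_subgroup[OF S generate.incl]; simp)+
  then have "x [^] u \<otimes> y [^] v \<in> generate G {x, y}"
    using subgroup.m_closed[OF S] by blast
  ultimately have gS: "g \<in> generate G {x, y}"
    by simp
  \<comment> \<open>This covers \<open>i = j = 0\<close> too: the gcd is then 0, the quotient is 0
    by convention, and both sides are \<open>\<one>\<close>.\<close>
  have "x = g [^] (i div gcd i j)"
    unfolding g_def int_pow_pow[OF c] i by simp
  moreover have "y = g [^] (j div gcd i j)"
    unfolding g_def int_pow_pow[OF c] j by simp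
  ultimately have "generate G {x, y} \<subseteq> generate G {g}"
    using g by (intro generate_subgroup_incl generate_is_subgroup) (auto intro: int_pow_mem_generate)
  moreover have "generate G {g} \<subseteq> generate G {x, y}"
    using gS x y by (simp add: generate_subgroup_incl generate_is_subgroup)
  ultimately have "generate G {x, y} = generate G {g}"
    by blast
  then have "subgroup_generated G {x, y} = subgroup_generated G {g}"
    using x y g by (simp add: subgroup_generated_def)
  then show ?L
    by (simp add: cyclic_group_generated)
qed

section \<open>Coprime exponents and orders in cyclic groups\<close>

text \<open>Bezout writes \<open>x\<close> as a product of powers of its \<open>a\<close>-th and
  \<open>b\<close>-th powers. With exponents \<open>p ^ a\<close> and \<open>m\<close> these replace
  the decomposition into p-part and p'-part.\<close>

lemma mem_subgroup_of_coprime_pow: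
  assumes "subgroup H G" and x: "x \<in> carrier G" and "coprime a b"
    and "x [^] (a::nat) \<in> H" "x [^] (b::nat) \<in> H"
  shows "x \<in> H"
proof -
  obtain u v where uv: "u * int a + v * int b = 1"
    using bezout_int[of "int a" "int b"] \<open>coprime a b\<close> by auto
  have "x = x [^] (u * int a + v * int b)"
    using x by (simp add: uv)
  also have "\<dots> = (x [^] a) [^] u \<otimes> (x [^] b) [^] v"
    using x by (simp add: int_pow_mult int_pow_pow int_pow_int[symmetric] mult.commute)
  also have "\<dots> \<in> H"
    using assms by (intro subgroup.m_closed int_pow_mem_subgroup)
  finally show ?thesis .
qed

lemma eq_one_of_coprime_pow:
  assumes "x \<in> carrier G" "coprime a b" "x [^] (a::nat) = \<one>" "x [^] (b::nat) = \<one>"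
  shows "x = \<one>"
  using mem_subgroup_of_coprime_pow[OF triv_subgroup assms(1,2)] assms(3,4) by simp

lemma pow_eq_one_of_mem_generate:
  assumes "x \<in> carrier G" "y \<in> generate G {x}" "x [^] (n::nat) = \<one>"
  shows "y [^] n = \<one>"
proof -
  obtain k :: int where k: "y = x [^] k"
    using assms generate_singleton_iff by blast
  have "y [^] n = (x [^] n) [^] k"
    using assms(1) by (simp add: k int_pow_int[symmetric] int_pow_pow mult.commute)
  then show ?thesis
    using assms(3) by simp
qed

text \<open>A finite cyclic group has a single subgroup of each order, so divisibility of orders
  decides containment.\<close>

lemma mem_generate_of_ord_dvd:
  assumes c: "c \<in> carrier G" "ord c \<noteq> 0" and xy: "x \<in> generate G {c}" "y \<in> generate G {c}"
    and dvd: "ord y dvd ord x"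
  shows "y \<in> generate G {x}"
proof -
  obtain i j :: int where i: "x = c [^] i" and j: "y = c [^] j"
    using xy c generate_singleton_iff by metis
  have x: "x \<in> carrier G" and y: "y \<in> carrier G"
    using c by (auto simp: i j)
  \<comment> \<open>The element \<open>c [^] d\<close> generates \<langle>x\<rangle>, and the order
    of \<open>x\<close> turns out to be \<open>n div d\<close>.\<close>
  define n d m where "n = int (ord c)" and "d = gcd i n" and "m = int (ord x)"
  have cpow: "c [^] k = \<one> \<longleftrightarrow> n dvd k" for k :: int
    using c int_pow_eq_id by (simp add: n_def)
  have xpow: "x [^] k = \<one> \<longleftrightarrow> m dvd k" for k :: int
    using x int_pow_eq_id by (simp add: m_def)
  have "n > 0"
    using c by (simp add: n_def)
  obtain u v where uv: "u * i + v * n = d"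
    using bezout_int d_def by metis
  have "c [^] n = \<one>"
    by (simp add: cpow)
  have "c [^] d = (c [^] i) [^] u \<otimes> (c [^] n) [^] v"
    using c by (simp add: int_pow_pow int_pow_mult[symmetric] uv[symmetric] mult.commute)
  then have cd: "c [^] d = x [^] u"
    using c x by (simp add: \<open>c [^] n = \<one>\<close> i)
  have "x [^] (n div d) = c [^] (n * (i div d))"
    using c by (simp add: i int_pow_pow d_def div_mult_swap mult.commute)
  then have "m dvd n div d"
    by (metis cpow xpow dvd_triv_left)
  then have "d * m dvd n"
    by (simp add: d_def dvd_div_iff_mult mult.commute \<open>n > 0\<close> less_imp_neq[symmetric])
  moreover have "c [^] (d * m) = (x [^] m) [^] u"
    using c x by (simp add: int_pow_pow[symmetric] cd) (simp add: int_pow_pow mult.commute)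
  then have "n dvd d * m"
    by (metis cpow xpow dvd_refl int_pow_one)
  ultimately have n: "n = d * m"
    using \<open>n > 0\<close> by (metis abs_of_nonneg abs_of_pos d_def gcd_ge_0_int m_def
        mult_nonneg_nonneg of_nat_0_le_iff zdvd_antisym_abs)
  have "y [^] m = \<one>"
    using y dvd int_pow_eq_id by (simp add: m_def)
  \<comment> \<open>Cancelling \<open>m\<close> in \<open>d * m dvd j * m\<close> makes
    \<open>y\<close> a power of \<open>c [^] d\<close>, which is itself a power of
    \<open>x\<close>.\<close>
  then have "n dvd j * m"
    using c cpow by (simp add: j int_pow_pow)
  then have "d dvd j"
    using n \<open>n > 0\<close> by (cases "m = 0") auto
  then have "y = (c [^] d) [^] (j div d)"
    using c by (simp add: j int_pow_pow)
  then show ?thesis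
    using x by (simp add: cd int_pow_pow int_pow_mem_generate)
qed

text \<open>Both orders are powers of \<open>p\<close>, and these form a chain under
  divisibility.\<close>

lemma prime_power_elements_comparable:
  assumes c: "c \<in> carrier G" "ord c \<noteq> 0" and xy: "x \<in> generate G {c}" "y \<in> generate G {c}"
    and p: "prime (p::nat)" "x [^] (p ^ a) = \<one>" "y [^] (p ^ a) = \<one>"
  shows "y \<in> generate G {x} \<or> x \<in> generate G {y}"
proof -
  have "x \<in> carrier G" "y \<in> carrier G"
    using generate_incl[of "{c}"] c xy by auto
  then obtain k l where "ord x = p ^ k" "ord y = p ^ l"
    using p by (metis divides_primepow_nat pow_eq_id)
  then have "ord y dvd ord x \<or> ord x dvd ord y"
    by (metis le_imp_power_dvd nle_le)
  then show ?thesis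
    using mem_generate_of_ord_dvd c xy by blast
qed

text \<open>The \<open>a\<close>-th power of \<open>z \<otimes> x\<close> is \<open>x [^] a\<close>
  and its \<open>b\<close>-th power is \<open>z [^] b\<close>; coprimality then recovers
  \<open>x\<close> and \<open>z\<close> themselves.\<close>

lemma common_cyclic_of_coprime_pow:
  assumes x: "x \<in> carrier G" and z: "z \<in> carrier G" and comm: "z \<otimes> x = x \<otimes> z"
    and "coprime a b" "z [^] (a::nat) = \<one>" "x [^] (b::nat) = \<one>"
  shows "x \<in> generate G {z \<otimes> x}" "z \<in> generate G {z \<otimes> x}"
proof -
  let ?H = "generate G {z \<otimes> x}"
  have H: "subgroup ?H G"
    using x z by (intro generate_is_subgroup) auto
  have pow: "z [^] k \<otimes> x [^] k \<in> ?H" for k :: nat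
    using nat_pow_mem_generate[of "z \<otimes> x" k] pow_mult_distrib[OF comm z x] x z by simp
  have "x [^] a \<in> ?H" "z [^] b \<in> ?H"
    using pow[of a] pow[of b] assms by auto
  moreover have "x [^] b \<in> ?H" "z [^] a \<in> ?H"
    using assms subgroup.one_closed[OF H] by auto
  ultimately show "x \<in> ?H" "z \<in> ?H"
    using mem_subgroup_of_coprime_pow[OF H] x z \<open>coprime a b\<close> by blast+
qed

section \<open>Cauchy's theorem and central elements of prime order\<close>

lemma exists_prime_order:
  assumes "finite (carrier G)" "prime p" "p dvd order G"
  shows "\<exists>x \<in> carrier G. ord x = p"
proof -
  \<comment> \<open>Sylow's existence theorem allows \<open>p\<close> to divide the cofactor, so
    exponent 1 yields a subgroup of order exactly \<open>p\<close>.\<close>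
  obtain m where "order G = p ^ 1 * m"
    using assms by auto
  then obtain H where H: "subgroup H G" "card H = p"
    using sylow_thm[OF assms(2) group_axioms _ assms(1)] by fastforce
  have "\<not> H \<subseteq> {\<one>}"
  proof
    assume "H \<subseteq> {\<one>}"
    then have "card H \<le> 1"
      using card_mono[of "{\<one>}" H] by simp
    then show False
      using H(2) prime_gt_1_nat[OF assms(2)] by simp
  qed
  then obtain x where x: "x \<in> H" "x \<noteq> \<one>"
    by blast
  have xG: "x \<in> carrier G"
    using x H(1) subgroup.subset by blast
  interpret K: group "G\<lparr>carrier := H\<rparr>"
    using H(1) by (rule subgroup_imp_group)
  have "x [^] p = \<one>"
    using K.pow_order_eq_1[of x] x H by (simp add: order_def nat_pow_consistent[symmetric])
  then have "ord x dvd p"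
    using xG pow_eq_id by simp
  moreover have "ord x \<noteq> 1"
    using x xG ord_eq_1 by simp
  ultimately show ?thesis
    using xG assms(2) prime_nat_iff by blast
qed

text \<open>If a prime \<open>p\<close> divides the order of a central \<open>w\<close>, the power
  of \<open>w\<close> with exponent \<open>ord w\<close> divided by \<open>p\<close> has order
  \<open>p\<close> and is still central.\<close>

lemma center_has_prime_order:
  assumes "finite (carrier G)" "center G \<noteq> {\<one>}"
  shows "\<exists>z \<in> center G. prime (ord z)"
proof -
  obtain w where w: "w \<in> center G" "w \<noteq> \<one>"
    using assms(2) by (auto simp: center_def)
  then have wG: "w \<in> carrier G" and comm: "\<And>g. g \<in> carrier G \<Longrightarrow> w \<otimes> g = g \<otimes> w"
    by (auto simp: center_def)
  have "ord w \<noteq> 1"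
    using w wG ord_eq_1 by simp
  then obtain p where p: "prime p" "p dvd ord w"
    using prime_factor_nat by blast
  then obtain k where k: "ord w = k * p"
    by (metis dvdE mult.commute)
  have "ord w > 0"
    using assms(1) wG ord_ge_1 by (simp add: Suc_le_eq)
  then have "ord (w [^] k) = p"
    using k wG ord_pow[of w k] by auto
  moreover have "w [^] k \<otimes> g = g \<otimes> w [^] k" if "g \<in> carrier G" for g
    using that wG comm by (induction k) (auto simp: m_assoc, metis m_assoc nat_pow_closed)
  then have "w [^] k \<in> center G"
    using wG by (simp add: center_def)
  ultimately show ?thesis
    using p by blast
qed

section \<open>Edges of the difference graph\<close>

lemma difference_graph_arc_iff:
  "(x, y) \<in> parcs (difference_graph G) \<longleftrightarrow>
    x \<in> carrier G \<and> y \<in> carrier G \<and> x \<notin> generate G {y} \<and> y \<notin> generate G {x} \<and>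
    (\<exists>c \<in> carrier G. x \<in> generate G {c} \<and> y \<in> generate G {c})"
  using difference_graph_adjacent_iff[OF group_axioms] cyclic_subgroup_generated_pair_iff
  by blast

lemma difference_graph_arc_commute:
  "(x, y) \<in> parcs (difference_graph G) \<longleftrightarrow> (y, x) \<in> parcs (difference_graph G)"
  by (auto simp: difference_graph_arc_iff)

text \<open>Below \<open>y\<close>, the common cyclic overgroup is inherited, and \<open>x\<close>
  cannot lie in \<langle>w\<rangle> since it is not in \<langle>y\<rangle>. Membership of
  \<open>w\<close> in \<langle>x\<rangle> is thus the only obstruction.\<close>

lemma difference_graph_arc_mem_generate:
  assumes "(x, y) \<in> parcs (difference_graph G)" "w \<in> generate G {y}" "w \<notin> generate G {x}"
  shows "(x, w) \<in> parcs (difference_graph G)"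
proof -
  have G: "x \<in> carrier G" "y \<in> carrier G" and x: "x \<notin> generate G {y}"
    using assms(1) by (auto simp: difference_graph_arc_iff)
  moreover have "w \<in> carrier G"
    using assms(2) G generate_incl[of "{y}"] by auto
  moreover have "generate G {w} \<subseteq> generate G {y}"
    using G(2) assms(2) by (rule generate_singleton_subset)
  moreover obtain c where "c \<in> carrier G" "x \<in> generate G {c}" "y \<in> generate G {c}"
    using assms(1) by (auto simp: difference_graph_arc_iff)
  moreover from this have "generate G {y} \<subseteq> generate G {c}"
    by (intro generate_singleton_subset)
  ultimately show ?thesis
    using assms(2,3) by (auto simp: difference_graph_arc_iff)
qed

text \<open>Coprime exponents make \<langle>x\<rangle> and \<langle>z\<rangle> meet trivially, so
  neither contains the generator of the other; centrality gives the commutation that puts both into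
  \<langle>z \<otimes> x\<rangle>.\<close>

lemma difference_graph_arc_central:
  assumes x: "x \<in> carrier G" "x \<noteq> \<one>" "x [^] (b::nat) = \<one>"
    and z: "z \<in> center G" "z \<noteq> \<one>" "z [^] (a::nat) = \<one>" and "coprime a b"
  shows "(x, z) \<in> parcs (difference_graph G)"
proof -
  have zG: "z \<in> carrier G" and comm: "z \<otimes> x = x \<otimes> z"
    using z(1) x(1) by (auto simp: center_def)
  have "x \<notin> generate G {z}"
    using eq_one_of_coprime_pow[OF x(1) \<open>coprime a b\<close>] pow_eq_one_of_mem_generate[OF zG _ z(3)] x
    by blast
  moreover have "z \<notin> generate G {x}"
    using eq_one_of_coprime_pow[OF zG \<open>coprime a b\<close>] pow_eq_one_of_mem_generate[OF x(1) _ x(3)] z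
    by blast
  ultimately show ?thesis
    using x(1) zG common_cyclic_of_coprime_pow[OF x(1) zG comm \<open>coprime a b\<close> z(3) x(3)]
    by (auto simp: difference_graph_arc_iff)
qed

text \<open>Up to the choice of a generator, exponent \<open>p ^ a\<close> extracts the p'-part of
  an element and exponent \<open>m\<close> its p-part.\<close>

lemma difference_graph_arc_pow:
  assumes fin: "finite (carrier G)" and p: "prime (p::nat)" "coprime (p ^ a) m" "order G = p ^ a * m"
    and xy: "(x, y) \<in> parcs (difference_graph G)"
  shows "(x, y [^] (p ^ a)) \<in> parcs (difference_graph G) \<or>
    (y, x [^] (p ^ a)) \<in> parcs (difference_graph G)"
proof (rule ccontr)
  assume contr: "\<not> ?thesis"
  have x: "x \<in> carrier G" "x \<notin> generate G {y}" and y: "y \<in> carrier G" "y \<notin> generate G {x}"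
    using xy by (auto simp: difference_graph_arc_iff)
  obtain c where c: "c \<in> carrier G" "x \<in> generate G {c}" "y \<in> generate G {c}"
    using xy by (auto simp: difference_graph_arc_iff)
  have "ord c \<noteq> 0"
    using ord_ge_1[OF fin c(1)] by simp
  have "y [^] (p ^ a) \<in> generate G {x}"
    using contr difference_graph_arc_mem_generate[OF xy nat_pow_mem_generate[OF y(1)]] by blast
  \<comment> \<open>If both coprime powers of \<open>y\<close> were in \<langle>x\<rangle>, so would
    be \<open>y\<close>, against the edge.\<close>
  then have ym: "y [^] m \<notin> generate G {x}"
    using mem_subgroup_of_coprime_pow[OF generate_is_subgroup y(1) p(2)] x y by auto
  have "x [^] (p ^ a) \<in> generate G {y}"
    using contr xy difference_graph_arc_mem_generate[OF _ nat_pow_mem_generate[OF x(1)]]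
      difference_graph_arc_commute by blast
  then have xm: "x [^] m \<notin> generate G {y}"
    using mem_subgroup_of_coprime_pow[OF generate_is_subgroup x(1) p(2)] x y by auto
  have pow: "(w [^] m) [^] (p ^ a) = \<one>" if "w \<in> carrier G" for w
    using pow_order_eq_1[OF that] that p(3) by (simp add: nat_pow_pow mult.commute)
  have "x [^] m \<in> generate G {c}" "y [^] m \<in> generate G {c}"
    using c generate_singleton_subset nat_pow_mem_generate x y by blast+
  \<comment> \<open>The two p-parts lie in the cyclic group \<langle>c\<rangle>, hence are
    comparable; either containment contradicts \<open>xm\<close> or \<open>ym\<close>.\<close>
  then have "y [^] m \<in> generate G {x [^] m} \<or> x [^] m \<in> generate G {y [^] m}"
    using prime_power_elements_comparable[OF c(1) \<open>ord c \<noteq> 0\<close> _ _ p(1)] pow x y by blast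
  then show False
    using xm ym generate_singleton_subset[OF x(1) nat_pow_mem_generate[OF x(1)]]
      generate_singleton_subset[OF y(1) nat_pow_mem_generate[OF y(1)]] by blast
qed

end

section \<open>Connectedness and diameter\<close>

theorem theorem3p1:
  fixes G :: "('a, 'b) monoid_scheme"
  assumes "group G"
    and "finite (carrier G)"
    and "\<not> (\<exists>p. prime p \<and> p_group p G)"
    and "center G \<noteq> {\<one>\<^bsub>G\<^esub>}"
  shows "Digraph_Component.connected (with_proj (difference_graph G)) \<and>
    diameter (difference_graph G) \<le> 6"
proof -
  interpret group G
    by (rule assms(1))
  let ?D = "difference_graph G"
  interpret D: pair_graph ?D
    by (rule pair_graph_difference_graph[OF assms(1,2)])
  obtain z where z: "z \<in> center G" "prime (ord z)"
    using center_has_prime_order[OF assms(2,4)] by blast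
  define p where "p = ord z"
  have p: "prime p" and zG: "z \<in> carrier G"
    using z by (auto simp: p_def center_def)
  have "order G > 0"
    using assms(2) order_gt_0_iff_finite by blast
  then obtain a m where am: "order G = p ^ a * m" "\<not> p dvd m"
    using p multiplicity_decompose'[of "order G" p] not_prime_unit by (metis less_irrefl)
  have "p dvd order G"
    using ord_dvd_group_order[OF zG] by (simp add: p_def)
  then have "a \<noteq> 0"
    using am by (cases a) auto
  have cop: "coprime (p ^ a) m"
    using am(2) p by (simp add: prime_imp_coprime)
  have "z \<noteq> \<one>\<^bsub>G\<^esub>"
    using z(2) by (metis not_prime_1 ord_id)
  have "z [^]\<^bsub>G\<^esub> (p ^ a) = \<one>\<^bsub>G\<^esub>"
    using pow_eq_id[OF zG] \<open>a \<noteq> 0\<close> by (simp add: p_def dvd_power)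
  \<comment> \<open>Every non-trivial element killed by \<open>m\<close> is a neighbour of
    \<open>z\<close>; \<open>a \<noteq> 0\<close> ensured that \<open>p ^ a\<close> kills
    \<open>z\<close>.\<close>
  note central = difference_graph_arc_central[OF _ _ _ z(1) \<open>z \<noteq> \<one>\<^bsub>G\<^esub>\<close> this cop]

  have arc_pow_central: "(y [^]\<^bsub>G\<^esub> (p ^ a), z) \<in> parcs ?D"
    if "(x, y [^]\<^bsub>G\<^esub> (p ^ a)) \<in> parcs ?D" "y \<in> carrier G" for x y
  proof (rule central)
    \<comment> \<open>The identity lies in every subgroup, so it is never the end of an
      edge.\<close>
    show "y [^]\<^bsub>G\<^esub> (p ^ a) \<noteq> \<one>\<^bsub>G\<^esub>"
      using that by (metis difference_graph_arc_iff generate.one)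
    show "(y [^]\<^bsub>G\<^esub> (p ^ a)) [^]\<^bsub>G\<^esub> m = \<one>\<^bsub>G\<^esub>"
      using pow_order_eq_1[of y] that(2) am(1) by (simp add: nat_pow_pow)
  qed (use that in simp)

  \<comment> \<open>Here \<open>G\<close> not being a p-group enters: an element of prime order
    dividing \<open>m\<close> is a neighbour of \<open>z\<close>, so \<open>z\<close> is a vertex
    and the graph is non-empty, as connectedness demands.\<close>
  have "m \<noteq> 1"
    using assms(1,3) p am(1) unfolding p_group_def by (metis mult.right_neutral)
  then obtain q where q: "prime q" "q dvd m"
    using prime_factor_nat by blast
  then obtain w where w: "w \<in> carrier G" "ord w = q"
    using exists_prime_order[OF assms(2)] am(1) by (metis dvd_mult)
  have "(w, z) \<in> parcs ?D"
    using q w pow_eq_id[OF w(1)] by (intro central) (auto simp: ord_id)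
  then have zV: "z \<in> pverts ?D"
    using D.in_arcsD2 by blast

  \<comment> \<open>Bounds on walk lengths add under concatenation, and a bounded walk gives both
    reachability and a bound on the distance.\<close>
  define W where "W k u v \<longleftrightarrow> (\<exists>es. D.awalk u es v \<and> length es \<le> k)" for k :: nat and u v
  have W_arc: "W 1 u v" if "(u, v) \<in> parcs ?D" for u v
    using that unfolding W_def
    by (intro exI[of _ "[(u, v)]"]) (auto simp: D.awalk_simps dest: D.in_arcsD1 D.in_arcsD2)
  have W_trans: "W (k + l) u v" if "W k u t" "W l t v" for k l u t v
    using that unfolding W_def by (metis D.awalk_appendI add_mono length_append)
  have W_mono: "W l u v" if "W k u v" "k \<le> l" for k l u v
    using that unfolding W_def by (meson order_trans)

  have W_z: "W 3 x z \<and> W 3 z x" if x: "x \<in> pverts ?D" for x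
  proof -
    have arc: "W 1 u v \<and> W 1 v u" if "(u, v) \<in> parcs ?D" for u v
      using that W_arc difference_graph_arc_commute by blast
    obtain y where xy: "(x, y) \<in> parcs ?D"
      using x difference_graph_arc_commute
      by (auto simp: difference_graph_def remove_isolated_def Field_def)
    then have G: "x \<in> carrier G" "y \<in> carrier G"
      by (auto simp: difference_graph_arc_iff)
    consider "(x, y [^]\<^bsub>G\<^esub> (p ^ a)) \<in> parcs ?D" | "(y, x [^]\<^bsub>G\<^esub> (p ^ a)) \<in> parcs ?D"
      using difference_graph_arc_pow[OF assms(2) p cop am(1) xy] by blast
    then show ?thesis
    proof cases
      \<comment> \<open>The walk is \<open>x\<close>, \<open>y [^] (p ^ a)\<close>,
        \<open>z\<close>, of length 2.\<close>
      case 1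
      note arc[OF 1] arc[OF arc_pow_central[OF 1 G(2)]]
      then have "W (1 + 1) x z \<and> W (1 + 1) z x"
        using W_trans by blast
      then show ?thesis
        using W_mono by fastforce
    next
      \<comment> \<open>The walk is \<open>x\<close>, \<open>y\<close>,
        \<open>x [^] (p ^ a)\<close>, \<open>z\<close>; its length 3, doubled by joining two walks
        at \<open>z\<close>, is the source of the bound 6.\<close>
      case 2
      note arc[OF xy] arc[OF 2] arc[OF arc_pow_central[OF 2 G(1)]]
      then have "W (1 + (1 + 1)) x z \<and> W (1 + 1 + 1) z x"
        using W_trans by blast
      then show ?thesis
        by (simp add: eval_nat_numeral)
    qed
  qed
  have W6: "W 6 u v" if "u \<in> pverts ?D" "v \<in> pverts ?D" for u v
    using W_trans[of 3 u z 3 v] W_z that by simp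

  \<comment> \<open>Connectedness of a digraph is strong connectedness of its symmetric
    closure.\<close>
  have "u \<rightarrow>\<^sup>*\<^bsub>with_proj (mk_symmetric (with_proj ?D))\<^esub> v"
    if "u \<in> pverts ?D" "v \<in> pverts ?D" for u v
    using W6[OF that] D.reachable_mk_symmetricI D.reachable_awalk unfolding W_def by blast
  then have "Digraph_Component.connected (with_proj ?D)"
    using zV unfolding Digraph_Component.connected_def
    by (intro strongly_connectedI) (auto simp: mk_symmetric_def)
  moreover have "diameter ?D \<le> 6"
    unfolding diameter_def
  proof (intro SUP_least)
    fix u v
    assume "u \<in> pverts ?D" "v \<in> pverts ?D"
    then obtain es where es: "D.awalk u es v" "length es \<le> 6"
      using W6 unfolding W_def by blast
    \<comment> \<open>The distance is an infimum over all walks, so a single walk bounds it from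
      above.\<close>
    have "graph_distance ?D u v \<le> ereal (real (length es))"
      unfolding graph_distance_eq_INF_length[OF D.pair_wf_digraph_axioms]
      using es(1) by (intro INF_lower) simp
    also have "\<dots> \<le> 6"
      using es(2) by simp
    finally show "graph_distance ?D u v \<le> 6" .
  qed
  ultimately show ?thesis ..
qed

end
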